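(* Suppose that $u_n$, $n=1,2,\ldots$, are fuzzy sets in $F_{USCGCON}(\mathbb{R}^m)$, and that $u\neq\widehat{\emptyset}$ is a fuzzy set in $F_{USCG}(\mathbb{R}^m)$. Then the following statements are equivalent (all limits as $n\to\infty$). (i) $H_{\rm end}(u_n,u)\to0$. (ii) $H([u_n]_\alpha,[u]_\alpha)\to0$ holds for almost every $\alpha\in(0,1)$. (iii) $H([u_n]_\alpha,[u]_\alpha)\to0$ holds for all $\alpha\in(0,1)\setminus P(u)$. (iv) $H([u_n]_\alpha,[u]_\alpha)\to0$ holds for all $\alpha\in P$, where $P$ is some dense subset of $(0,1)\setminus P(u)$. (v) $H([u_n]_\alpha,[u]_\alpha)\to0$ holds for all $\alpha\in P$, where $P$ is some countable dense subset of $(0,1)\setminus P(u)$. (vi) $u_n$ $\Gamma$-converges to $u$. (vii) $\lim_{n\to\infty}[u_n]_\alpha\,(K)=[u]_\alpha$ for all $\alpha\in(0,1)\setminus P(u)$. (viii) $\lim_{n\to\infty}[u_n]_\alpha\,(K)=[u]_\alpha=\emptyset$ for each $\alpha\in(\lambda_u,1]$, and $H([u_n]_\alpha,[u]_\alpha)\to0$ for all $\alpha\in(0,\lambda_u)\setminus P(u)$. (ix) $\lim_{n\to\infty}[u_n]_\alpha\,(K)=[u]_\alpha$ holds for almost every $\alpha\in(0,1)$. (x) $\lim_{n\to\infty}[u_n]_\alpha\,(K)=[u]_\alpha=\emptyset$ for each $\alpha\in(\lambda_u,1]$, and $H([u_n]_\alpha,[u]_\alpha)\to0$ holds for almost every $\alpha\in(0,\lambda_u)$.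 (xi) $\lim_{n\to\infty}[u_n]_\alpha\,(K)=[u]_\alpha$ holds for all $\alpha\in P$, where $P$ is some dense subset of $(0,1)\setminus P(u)$. (xii) $\lim_{n\to\infty}[u_n]_\alpha\,(K)=[u]_\alpha=\emptyset$ for each $\alpha\in(\lambda_u,1]$, and $H([u_n]_\alpha,[u]_\alpha)\to0$ holds for all $\alpha\in P\cap(0,\lambda_u)$, where $P$ is some dense subset of $(0,1)\setminus P(u)$. (xiii) $\lim_{n\to\infty}[u_n]_\alpha\,(K)=[u]_\alpha$ holds for all $\alpha\in P$, where $P$ is some countable dense subset of $(0,1)\setminus P(u)$. (xiv) $\lim_{n\to\infty}[u_n]_\alpha\,(K)=[u]_\alpha=\emptyset$ for each $\alpha\in(\lambda_u,1]$, and $H([u_n]_\alpha,[u]_\alpha)\to0$ holds for all $\alpha\in P\cap(0,\lambda_u)$, where $P$ is some countable dense subset of $(0,1)\setminus P(u)$.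
   Context: A fuzzy set on $\mathbb{R}^m$ is a function $u:\mathbb{R}^m\to[0,1]$; $\widehat{\emptyset}$ denotes the identically zero fuzzy set. For $\alpha\in(0,1]$, $[u]_\alpha=\{x:u(x)\ge\alpha\}$ and $\{u>\alpha\}=\{x:u(x)>\alpha\}$; $[u]_0=\overline{\{x:u(x)>0\}}$. $F_{USCG}(\mathbb{R}^m)$ is the set of all upper semi-continuous fuzzy sets $u$ on $\mathbb{R}^m$ with $[u]_\alpha$ bounded for each $\alpha\in(0,1]$ (cuts may be empty). $F_{USCGCON}(\mathbb{R}^m)$ is the set of all $u\in F_{USCG}(\mathbb{R}^m)$ such that $[u]_\alpha$ is connected for each $\alpha\in(0,1]$ (the empty set counts as connected). $P(u)$ is the set of platform points of $u$: those $\alpha\in(0,1)$ with $\overline{\{u>\alpha\}}\subsetneqq[u]_\alpha$. For $u\in F_{USCG}(\mathbb{R}^m)$, $u\ne\widehat{\emptyset}$, $\lambda_u\in(0,1]$ is the unique number such that, for $\beta\in[0,1]$, $[u]_\beta\ne\emptyset$ if and only if $\beta\in[0,\lambda_u]$; if $\lambda_u=1$ then $(\lambda_u,1]=\emptyset$. "Almost every" refers to Lebesgue measure. $H$ is the Hausdorff metric, $H(A,B)=\max\{\sup_{a\in A}\inf_{b\in B}d(a,b),\ \sup_{b\in B}\inf_{a\in A}d(a,b)\}$ for nonempty closed sets ($d$ Euclidean), extended by $H(\emptyset,\emptyset)=0$ and $H(\emptyset,A)=H(A,\emptyset)=+\infty$ for $A\ne\emptyset$. The endograph of $u$ is ${\rm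 end}\,u=\{(x,t)\in\mathbb{R}^m\times[0,1]:u(x)\ge t\}$ and $H_{\rm end}(u,v)=H({\rm end}\,u,{\rm end}\,v)$. Kuratowski convergence: $\liminf_n C_n$ is the set of $x=\lim_n x_n$ with $x_n\in C_n$ for all sufficiently large $n$, and $\limsup_n C_n$ is the set of $x=\lim_j x_{n_j}$ with $x_{n_j}\in C_{n_j}$ along some subsequence; $\lim_n C_n\,(K)=C$ means $C=\liminf_n C_n=\limsup_n C_n$. $u_n$ $\Gamma$-converges to $u$ if $\lim_n{\rm end}\,u_n\,(K)={\rm end}\,u$. *)

theory Defs
  imports "HOL-Analysis.Analysis"
begin

section \<open>Fuzzy sets and their cuts\<close>

text \<open>A fuzzy set is a real-valued function with values in \<open>[0,1]\<close>; the range condition is part of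
  the membership predicate \<open>F_USCG\<close> below.\<close>

type_synonym 'a fuzzy = "'a \<Rightarrow> real"

definition empty_fuzzy :: "'a fuzzy" where
  "empty_fuzzy = (\<lambda>x. 0)"

definition strong_cut :: "'a fuzzy \<Rightarrow> real \<Rightarrow> 'a set" where
  "strong_cut u \<alpha> = {x. u x > \<alpha>}"

text \<open>The 0-cut is the closed support, not \<open>{x. u x \<ge> 0}\<close>.\<close>

definition level_cut :: "'a::topological_space fuzzy \<Rightarrow> real \<Rightarrow> 'a set" where
  "level_cut u \<alpha> = (if \<alpha> = 0 then closure (strong_cut u 0) else {x. u x \<ge> \<alpha>})"

definition upper_semicontinuous :: "('a::topological_space \<Rightarrow> real) \<Rightarrow> bool" where
  "upper_semicontinuous u \<longleftrightarrow> (\<forall>x. \<forall>b>u x. \<forall>\<^sub>F y in nhds x. u y < b)"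

definition F_USCG :: "'a::metric_space fuzzy set" where
  "F_USCG = {u. (\<forall>x. u x \<in> {0..1}) \<and> upper_semicontinuous u \<and> (\<forall>\<alpha>\<in>{0<..1}. bounded (level_cut u \<alpha>))}"

definition F_USCGCON :: "'a::metric_space fuzzy set" where
  "F_USCGCON = {u \<in> F_USCG. \<forall>\<alpha>\<in>{0<..1}. connected (level_cut u \<alpha>)}"

definition platform_points :: "'a::topological_space fuzzy \<Rightarrow> real set" where
  "platform_points u = {\<alpha> \<in> {0<..<1}. closure (strong_cut u \<alpha>) \<subset> level_cut u \<alpha>}"

text \<open>Only meaningful for \<open>u \<in> F_USCG\<close> with \<open>u \<noteq> empty_fuzzy\<close>; see \<open>top_level_unique\<close>.\<close>

definition top_level :: "'a::topological_space fuzzy \<Rightarrow> real" where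
  "top_level u = (THE l. l \<in> {0<..1} \<and> (\<forall>\<beta>\<in>{0..1}. level_cut u \<beta> \<noteq> {} \<longleftrightarrow> \<beta> \<in> {0..l}))"

definition endograph :: "'a fuzzy \<Rightarrow> ('a \<times> real) set" where
  "endograph u = {(x, t). t \<in> {0..1} \<and> u x \<ge> t}"


section \<open>Hausdorff distance and Kuratowski convergence\<close>

text \<open>In \<^typ>\<open>ennreal\<close> a supremum over the empty set is 0 and an infimum over it is \<open>\<infinity>\<close>, so this one
  formula also yields the conventions for the empty set (\<open>hausdorff_empty\<close>).\<close>

definition hausdorff :: "'a::metric_space set \<Rightarrow> 'a set \<Rightarrow> ennreal" where
  "hausdorff A B = max (SUP a\<in>A. INF b\<in>B. ennreal (dist a b)) (SUP b\<in>B. INF a\<in>A. ennreal (dist a b))"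

lemma hausdorff_empty:
  "hausdorff {} {} = 0"
  "A \<noteq> {} \<Longrightarrow> hausdorff {} A = \<infinity>"
  "A \<noteq> {} \<Longrightarrow> hausdorff A {} = \<infinity>"
  by (simp_all add: hausdorff_def bot_ennreal)

text \<open>The distance on the product type is the Euclidean one.\<close>

definition H_end :: "'a::metric_space fuzzy \<Rightarrow> 'a fuzzy \<Rightarrow> ennreal" where
  "H_end u v = hausdorff (endograph u) (endograph v)"

definition K_liminf :: "(nat \<Rightarrow> 'a::topological_space set) \<Rightarrow> 'a set" where
  "K_liminf C = {x. \<exists>s. (\<forall>\<^sub>F n in sequentially. s n \<in> C n) \<and> s \<longlonglongrightarrow> x}"

definition K_limsup :: "(nat \<Rightarrow> 'a::topological_space set) \<Rightarrow> 'a set" where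
  "K_limsup C = {x. \<exists>r s. strict_mono r \<and> (\<forall>j. s j \<in> C (r j)) \<and> s \<longlonglongrightarrow> x}"

definition K_lim :: "(nat \<Rightarrow> 'a::topological_space set) \<Rightarrow> 'a set \<Rightarrow> bool" where
  "K_lim C L \<longleftrightarrow> L = K_liminf C \<and> L = K_limsup C"

definition Gamma_converges :: "(nat \<Rightarrow> 'a::topological_space fuzzy) \<Rightarrow> 'a fuzzy \<Rightarrow> bool" where
  "Gamma_converges U u \<longleftrightarrow> K_lim (\<lambda>n. endograph (U n)) (endograph u)"

definition dense_subset :: "'a::topological_space set \<Rightarrow> 'a set \<Rightarrow> bool" where
  "dense_subset P S \<longleftrightarrow> P \<subseteq> S \<and> S \<subseteq> closure P"


section \<open>Well-definedness of the top level\<close>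

lemma closed_level_cut:
  assumes "upper_semicontinuous u"
  shows "closed (level_cut u \<alpha>)"
proof (cases "\<alpha> = 0")
  case False
  have "open {x. u x < \<alpha>}"
  proof (subst open_subopen, intro ballI)
    fix x assume "x \<in> {x. u x < \<alpha>}"
    then have "\<forall>\<^sub>F y in nhds x. u y < \<alpha>" using assms by (simp add: upper_semicontinuous_def)
    then show "\<exists>T. open T \<and> x \<in> T \<and> T \<subseteq> {x. u x < \<alpha>}"
      by (auto simp: eventually_nhds)
  qed
  moreover have "level_cut u \<alpha> = - {x. u x < \<alpha>}"
    using False by (auto simp: level_cut_def)
  ultimately show ?thesis by (simp add: closed_def)
qed (simp add: level_cut_def)

lemma F_USCG_attains_max:
  fixes u :: "'a::heine_borel fuzzy"
  assumes u: "u \<in> F_USCG" and ne: "u \<noteq> empty_fuzzy"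
  obtains x where "0 < u x" "\<And>y. u y \<le> u x"
proof -
  have rng: "0 \<le> u x" "u x \<le> 1" for x using u by (auto simp: F_USCG_def)
  have usc: "upper_semicontinuous u" using u by (simp add: F_USCG_def)
  obtain x0 where "u x0 \<noteq> 0" using ne by (auto simp: empty_fuzzy_def fun_eq_iff)
  then have x0: "0 < u x0" using rng(1)[of x0] by simp
  let ?K = "level_cut u (u x0)"
  have "compact ?K"
    using u x0 rng(2)[of x0] closed_level_cut[OF usc] by (auto simp: F_USCG_def compact_eq_bounded_closed)
  have cutge: "level_cut u (u y) = {x. u x \<ge> u y}" if "y \<in> ?K" for y
    using that x0 by (auto simp: level_cut_def)
  have "?K \<inter> (\<Inter>y\<in>?K. level_cut u (u y)) \<noteq> {}"
  proof (rule compact_imp_fip_image[OF \<open>compact ?K\<close>])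
    fix I assume I: "finite I" "I \<subseteq> ?K"
    show "?K \<inter> (\<Inter>y\<in>I. level_cut u (u y)) \<noteq> {}"
    proof (cases "I = {}")
      case True
      then show ?thesis using x0 by (auto simp: level_cut_def)
    next
      case False
      obtain z where z: "z \<in> I" "\<forall>y\<in>I. u y \<le> u z"
        using I(1) False Max_in[of "u ` I"] Max_ge[of "u ` I"] by fastforce
      then have "z \<in> ?K \<inter> (\<Inter>y\<in>I. level_cut u (u y))" using I cutge by auto
      then show ?thesis by blast
    qed
  qed (simp add: closed_level_cut usc)
  then obtain x where x: "x \<in> ?K" "\<And>y. y \<in> ?K \<Longrightarrow> u y \<le> u x" using cutge by auto
  have "u x \<ge> u x0" using x(1) x0 by (simp add: level_cut_def)
  then have "u y \<le> u x" for y
    using x(2)[of y] x0 by (cases "u y \<ge> u x0") (auto simp: level_cut_def)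
  moreover have "0 < u x" using \<open>u x \<ge> u x0\<close> x0 by simp
  ultimately show thesis using that by blast
qed

lemma top_level_unique:
  fixes u :: "'a::heine_borel fuzzy"
  assumes u: "u \<in> F_USCG" and ne: "u \<noteq> empty_fuzzy"
  shows "\<exists>!l. l \<in> {0<..1} \<and> (\<forall>\<beta>\<in>{0..1}. level_cut u \<beta> \<noteq> {} \<longleftrightarrow> \<beta> \<in> {0..l})"
proof -
  obtain x where x: "0 < u x" "\<And>y. u y \<le> u x" using F_USCG_attains_max[OF assms] by metis
  have "u x \<le> 1" using u by (auto simp: F_USCG_def)
  have iff: "level_cut u \<beta> \<noteq> {} \<longleftrightarrow> \<beta> \<in> {0..u x}" if "\<beta> \<in> {0..1}" for \<beta>
  proof (cases "\<beta> = 0")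
    case True
    have "strong_cut u 0 \<noteq> {}" using x(1) by (auto simp: strong_cut_def)
    then show ?thesis using True x(1) by (simp add: level_cut_def)
  next
    case False
    have "(\<exists>y. \<beta> \<le> u y) \<longleftrightarrow> \<beta> \<le> u x" by (meson x(2) order_trans)
    then show ?thesis using False that by (simp add: level_cut_def)
  qed
  show ?thesis
  proof (rule ex1I[of _ "u x"])
    show "u x \<in> {0<..1} \<and> (\<forall>\<beta>\<in>{0..1}. level_cut u \<beta> \<noteq> {} \<longleftrightarrow> \<beta> \<in> {0..u x})"
      using iff x(1) \<open>u x \<le> 1\<close> by simp
  next
    fix l assume l: "l \<in> {0<..1} \<and> (\<forall>\<beta>\<in>{0..1}. level_cut u \<beta> \<noteq> {} \<longleftrightarrow> \<beta> \<in> {0..l})"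
    have "l \<le> u x" using l iff[of l] by simp
    moreover have "u x \<le> l" using l iff[of "u x"] x(1) \<open>u x \<le> 1\<close> by simp
    ultimately show "l = u x" by simp
  qed
qed

end

theory Submission
  imports Defs
begin

text \<open>
  All conditions are tied to \<open>\<Gamma>\<close>-convergence, that is, Kuratowski convergence of the endographs.

  Convergence in the Hausdorff metric to a closed set implies Kuratowski convergence
  (\<open>hausdorff_imp_K_lim\<close>). For the endographs this gives \<open>\<Gamma>\<close>-convergence at once. The conditions on
  cuts yield Kuratowski convergence of the cuts for a dense set of levels in \<open>(0,1)\<close>: a property
  that holds almost everywhere holds on a dense set (\<open>AE_imp_dense_subset\<close>), and there are only countably many platform points
  (\<open>countable_platform_points\<close>), so their complement is dense. A dense set of levels suffices to
  recover the endographs (\<open>dense_K_lim_cuts_imp_Gamma\<close>), since each height is approximated by such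
  levels from below.

  Conversely, let \<open>U n\<close> be \<open>\<Gamma>\<close>-convergent to \<open>u\<close>. The limit superior of the cuts at \<open>\<alpha>\<close> is contained
  in the cut of \<open>u\<close>, and the limit inferior contains the strong cut and hence its closure; off the
  platform points this is Kuratowski convergence of the cuts (\<open>Gamma_imp_K_lim_cut\<close>). To obtain the
  Hausdorff metric, the cuts must not lose parts to infinity. Here the connectedness of the cuts of
  \<open>U n\<close> is decisive: a connected set with a point inside a ball and no point on its sphere lies in
  the ball, and the cuts eventually miss a sphere around the compact cut of \<open>u\<close>
  (\<open>Gamma_connected_imp_bounded\<close>). On a fixed compact set Kuratowski and Hausdorff convergence to a
  compact set agree (\<open>K_lim_imp_hausdorff\<close>), which settles the cuts; for the endographs it is applied
  above a small positive height, below which all endographs are close to their common bottom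
  (\<open>Gamma_bounded_imp_H_end\<close>).
\<close>

section \<open>Kuratowski limits and the Hausdorff distance\<close>

text \<open>Eventual and frequent closeness replace the sequences of the definitions, so that the later
  arguments about Kuratowski limits are manipulations of \<open>\<forall>\<^sub>F\<close> and \<open>\<exists>\<^sub>F\<close> without choices of
  points or subsequences.\<close>

lemma K_liminf_iff:
  fixes C :: "nat \<Rightarrow> 'a::metric_space set"
  shows "x \<in> K_liminf C \<longleftrightarrow> (\<forall>e>0. \<forall>\<^sub>F n in sequentially. \<exists>y\<in>C n. dist y x < e)"
proof
  assume "x \<in> K_liminf C"
  then obtain s where s: "\<forall>\<^sub>F n in sequentially. s n \<in> C n" "s \<longlonglongrightarrow> x"
    by (auto simp: K_liminf_def)
  show "\<forall>e>0. \<forall>\<^sub>F n in sequentially. \<exists>y\<in>C n. dist y x < e"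
  proof (intro allI impI)
    fix e :: real assume "e > 0"
    with s(2) have "\<forall>\<^sub>F n in sequentially. dist (s n) x < e" by (simp add: tendsto_iff)
    with s(1) show "\<forall>\<^sub>F n in sequentially. \<exists>y\<in>C n. dist y x < e"
      by eventually_elim auto
  qed
next
  assume near: "\<forall>e>0. \<forall>\<^sub>F n in sequentially. \<exists>y\<in>C n. dist y x < e"
  have ne: "\<forall>\<^sub>F n in sequentially. C n \<noteq> {}"
    using near[rule_format, OF zero_less_one] by eventually_elim auto
  \<comment> \<open>an almost nearest point of \<open>C n\<close>, since a nearest one need not exist\<close>
  have "\<exists>y. C n \<noteq> {} \<longrightarrow> y \<in> C n \<and> dist y x \<le> infdist x (C n) + inverse (Suc n)" for n
  proof (cases "C n = {}")
    case False
    then have "(INF y\<in>C n. dist x y) < infdist x (C n) + inverse (Suc n)"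
      by (simp add: infdist_def)
    then obtain y where "y \<in> C n" "dist x y < infdist x (C n) + inverse (Suc n)"
      using False by (subst (asm) cINF_less_iff) auto
    then show ?thesis by (metis dist_commute less_imp_le)
  qed auto
  then obtain s where s: "\<And>n. C n \<noteq> {} \<Longrightarrow> s n \<in> C n"
    "\<And>n. C n \<noteq> {} \<Longrightarrow> dist (s n) x \<le> infdist x (C n) + inverse (Suc n)" by metis
  have "s \<longlonglongrightarrow> x"
    unfolding tendsto_iff
  proof (intro allI impI)
    fix e :: real assume "e > 0"
    then have "\<forall>\<^sub>F n in sequentially. \<exists>y\<in>C n. dist y x < e / 2"
      using near half_gt_zero by blast
    moreover have "\<forall>\<^sub>F n in sequentially. inverse (real (Suc n)) < e / 2"
      using order_tendstoD(2)[OF LIMSEQ_inverse_real_of_nat, of "e / 2"] \<open>e > 0\<close> by simp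
    ultimately show "\<forall>\<^sub>F n in sequentially. dist (s n) x < e"
    proof eventually_elim
      case (elim n)
      then obtain y where y: "y \<in> C n" "dist y x < e / 2" by auto
      then have "infdist x (C n) \<le> dist x y" by (intro infdist_le)
      moreover have "dist (s n) x \<le> infdist x (C n) + inverse (real (Suc n))"
        using s(2) y(1) by blast
      ultimately show ?case using y(2) elim(2) by (simp add: dist_commute)
    qed
  qed
  moreover have "\<forall>\<^sub>F n in sequentially. s n \<in> C n"
    using ne by eventually_elim (use s in auto)
  ultimately show "x \<in> K_liminf C" by (auto simp: K_liminf_def)
qed

lemma K_limsup_iff:
  fixes C :: "nat \<Rightarrow> 'a::metric_space set"
  shows "x \<in> K_limsup C \<longleftrightarrow> (\<forall>e>0. \<exists>\<^sub>F n in sequentially. \<exists>y\<in>C n. dist y x < e)"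
proof
  assume "x \<in> K_limsup C"
  then obtain r s where rs: "strict_mono r" "\<And>j. s j \<in> C (r j)" "s \<longlonglongrightarrow> x"
    by (auto simp: K_limsup_def)
  show "\<forall>e>0. \<exists>\<^sub>F n in sequentially. \<exists>y\<in>C n. dist y x < e"
  proof (intro allI impI)
    fix e :: real assume "e > 0"
    with rs(3) have ev: "\<forall>\<^sub>F j in sequentially. dist (s j) x < e" by (simp add: tendsto_iff)
    show "\<exists>\<^sub>F n in sequentially. \<exists>y\<in>C n. dist y x < e"
      unfolding frequently_sequentially
    proof
      fix N
      obtain j where "j \<ge> N" "dist (s j) x < e"
        using ev unfolding eventually_sequentially by (meson linear order_refl)
      moreover have "r j \<ge> j" using rs(1) by (rule strict_mono_imp_increasing)
      ultimately show "\<exists>n\<ge>N. \<exists>y\<in>C n. dist y x < e" using rs(2) by (meson order_trans)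
    qed
  qed
next
  assume near: "\<forall>e>0. \<exists>\<^sub>F n in sequentially. \<exists>y\<in>C n. dist y x < e"
  have pick: "\<exists>n>N. \<exists>y\<in>C n. dist y x < inverse (real (Suc j))" for N j
  proof -
    have "\<exists>\<^sub>F n in sequentially. \<exists>y\<in>C n. dist y x < inverse (real (Suc j))"
      using near by simp
    then show ?thesis
      unfolding frequently_sequentially by (meson Suc_le_eq)
  qed
  have "\<exists>r. \<forall>j. (\<exists>y\<in>C (r j). dist y x < inverse (real (Suc j))) \<and> r j < r (Suc j)"
  proof (rule dependent_nat_choice)
    show "\<exists>m. \<exists>y\<in>C m. dist y x < inverse (real (Suc 0))" using pick by blast
  next
    fix m j
    show "\<exists>k. (\<exists>y\<in>C k. dist y x < inverse (real (Suc (Suc j)))) \<and> m < k" using pick by blast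
  qed
  then obtain r where r: "\<And>j. \<exists>y\<in>C (r j). dist y x < inverse (real (Suc j))"
    "\<And>j. r j < r (Suc j)" by blast
  then obtain s where s: "\<And>j. s j \<in> C (r j)" "\<And>j. dist (s j) x < inverse (real (Suc j))"
    by metis
  have "(\<lambda>j. dist (s j) x) \<longlonglongrightarrow> 0"
    by (rule tendsto_sandwich[OF _ _ tendsto_const LIMSEQ_inverse_real_of_nat])
      (use s(2) in \<open>auto intro!: always_eventually less_imp_le\<close>)
  then have "s \<longlonglongrightarrow> x" by (rule tendsto_dist_iff[THEN iffD2])
  moreover have "strict_mono r" using r(2) by (simp add: strict_mono_Suc_iff)
  ultimately show "x \<in> K_limsup C" using s(1) by (auto simp: K_limsup_def)
qed

lemma K_limI:
  fixes C :: "nat \<Rightarrow> 'a::metric_space set"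
  assumes "L \<subseteq> K_liminf C" and "K_limsup C \<subseteq> L"
  shows "K_lim C L"
proof -
  have "K_liminf C \<subseteq> K_limsup C"
    by (auto simp: K_liminf_iff K_limsup_iff intro!: eventually_frequently)
  with assms show ?thesis by (auto simp: K_lim_def)
qed

lemma closed_K_liminf:
  fixes C :: "nat \<Rightarrow> 'a::metric_space set"
  shows "closed (K_liminf C)"
proof -
  have "x \<in> K_liminf C" if x: "x \<in> closure (K_liminf C)" for x
    unfolding K_liminf_iff
  proof (intro allI impI)
    fix e :: real assume "e > 0"
    then obtain y where y: "y \<in> K_liminf C" "dist y x < e / 2"
      using x by (meson closure_approachable half_gt_zero)
    then have "\<forall>\<^sub>F n in sequentially. \<exists>z\<in>C n. dist z y < e / 2"
      using \<open>e > 0\<close> unfolding K_liminf_iff by (meson half_gt_zero)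
    then show "\<forall>\<^sub>F n in sequentially. \<exists>z\<in>C n. dist z x < e"
      by eventually_elim (use y(2) in \<open>metis dist_commute dist_triangle_half_l\<close>)
  qed
  then show ?thesis by (metis closure_subset closure_eq subsetI subset_antisym)
qed

text \<open>Every point of \<open>K\<close> has a ball that eventually misses \<open>C n\<close>, and finitely many of these balls
  cover \<open>K\<close>.\<close>

lemma eventually_disjoint_compact:
  fixes C :: "nat \<Rightarrow> 'a::metric_space set"
  assumes K: "compact K" and disj: "K \<inter> K_limsup C = {}"
  shows "\<forall>\<^sub>F n in sequentially. C n \<inter> K = {}"
proof -
  have "\<forall>x\<in>K. \<exists>e>0. \<forall>\<^sub>F n in sequentially. C n \<inter> ball x e = {}"
  proof
    fix x assume "x \<in> K"
    then have "x \<notin> K_limsup C" using disj by auto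
    then obtain e where "e > 0" and e: "\<not> (\<exists>\<^sub>F n in sequentially. \<exists>y\<in>C n. dist y x < e)"
      unfolding K_limsup_iff by blast
    from e have "\<forall>\<^sub>F n in sequentially. C n \<inter> ball x e = {}"
      unfolding not_frequently by eventually_elim (auto simp: dist_commute)
    with \<open>e > 0\<close> show "\<exists>e>0. \<forall>\<^sub>F n in sequentially. C n \<inter> ball x e = {}" by blast
  qed
  then obtain e where e: "\<And>x. x \<in> K \<Longrightarrow> e x > 0"
    "\<And>x. x \<in> K \<Longrightarrow> \<forall>\<^sub>F n in sequentially. C n \<inter> ball x (e x) = {}"
    by metis
  have "K \<subseteq> (\<Union>x\<in>K. ball x (e x))" using e(1) by force
  then obtain F where F: "F \<subseteq> K" "finite F" "K \<subseteq> (\<Union>x\<in>F. ball x (e x))"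
    by (rule compactE_image[OF K open_ball])
  have "\<forall>\<^sub>F n in sequentially. \<forall>x\<in>F. C n \<inter> ball x (e x) = {}"
    using F(1,2) e(2) by (intro eventually_ball_finite) auto
  then show ?thesis by eventually_elim (use F(3) in blast)
qed

text \<open>The part of \<open>K\<close> outside the \<open>e\<close>-neighbourhood of \<open>A\<close> is compact and contains no limit superior
  point, so \<open>C n\<close> eventually misses it.\<close>

lemma eventually_near_limit:
  fixes C :: "nat \<Rightarrow> 'a::metric_space set"
  assumes K: "compact K" and C: "\<forall>\<^sub>F n in sequentially. C n \<subseteq> K"
    and A: "K_limsup C \<subseteq> A" and e: "e > 0"
  shows "\<forall>\<^sub>F n in sequentially. \<forall>c\<in>C n. \<exists>a\<in>A. dist c a < e"
proof -
  let ?N = "\<Union>a\<in>A. ball a e"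
  have "compact (K - ?N)" using K by (intro compact_diff) auto
  moreover have "(K - ?N) \<inter> K_limsup C = {}"
    using A e by force
  ultimately have "\<forall>\<^sub>F n in sequentially. C n \<inter> (K - ?N) = {}"
    by (rule eventually_disjoint_compact)
  with C show ?thesis by eventually_elim (force simp: dist_commute)
qed

text \<open>Closeness at each single point of \<open>A\<close> becomes uniform on passing to a finite \<open>e/2\<close>-net of \<open>A\<close>.\<close>

lemma eventually_limit_near:
  fixes C :: "nat \<Rightarrow> 'a::metric_space set"
  assumes A: "compact A" and sub: "A \<subseteq> K_liminf C" and e: "e > 0"
  shows "\<forall>\<^sub>F n in sequentially. \<forall>a\<in>A. \<exists>c\<in>C n. dist c a < e"
proof -
  have "A \<subseteq> (\<Union>x\<in>A. ball x (e / 2))" using e by force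
  then obtain F where F: "F \<subseteq> A" "finite F" "A \<subseteq> (\<Union>x\<in>F. ball x (e / 2))"
    by (rule compactE_image[OF A open_ball])
  have "\<forall>\<^sub>F n in sequentially. \<forall>x\<in>F. \<exists>c\<in>C n. dist c x < e / 2"
  proof (intro eventually_ball_finite ballI)
    fix x assume "x \<in> F"
    then have "x \<in> K_liminf C" using F(1) sub by blast
    then show "\<forall>\<^sub>F n in sequentially. \<exists>c\<in>C n. dist c x < e / 2"
      unfolding K_liminf_iff using half_gt_zero[OF e] by blast
  qed (rule F)
  then show ?thesis
  proof eventually_elim
    case (elim n)
    show ?case
    proof
      fix a assume "a \<in> A"
      then obtain x where x: "x \<in> F" "dist x a < e / 2" using F(3) by auto
      with elim obtain c where "c \<in> C n" "dist c x < e / 2" by blast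
      with x show "\<exists>c\<in>C n. dist c a < e" by (metis dist_commute dist_triangle_half_l)
    qed
  qed
qed

text \<open>The equivalence includes the empty sets: if \<open>A = {}\<close>, the right-hand side forces \<open>C n = {}\<close>
  eventually, as does the value \<open>\<infinity>\<close> of the distance between an empty and a nonempty set.\<close>

lemma hausdorff_tendsto_0_iff:
  fixes C :: "nat \<Rightarrow> 'a::metric_space set"
  shows "(\<lambda>n. hausdorff (C n) A) \<longlonglongrightarrow> 0 \<longleftrightarrow>
    (\<forall>e>0. (\<forall>\<^sub>F n in sequentially. \<forall>c\<in>C n. \<exists>a\<in>A. dist c a < e) \<and>
           (\<forall>\<^sub>F n in sequentially. \<forall>a\<in>A. \<exists>c\<in>C n. dist c a < e))"
    (is "?lim \<longleftrightarrow> ?near")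
proof
  assume lim: ?lim
  have less: "(\<forall>c\<in>B. \<exists>a\<in>A. dist c a < e) \<and> (\<forall>a\<in>A. \<exists>c\<in>B. dist c a < e)"
    if "hausdorff B A < ennreal e" for B e
  proof -
    have 1: "(SUP c\<in>B. INF a\<in>A. ennreal (dist c a)) < ennreal e"
      and 2: "(SUP a\<in>A. INF c\<in>B. ennreal (dist c a)) < ennreal e"
      using that by (simp_all add: hausdorff_def)
    have "(INF a\<in>A. ennreal (dist c a)) < ennreal e" if "c \<in> B" for c
      using le_less_trans[OF SUP_upper[OF that] 1] .
    moreover have "(INF c\<in>B. ennreal (dist c a)) < ennreal e" if "a \<in> A" for a
      using le_less_trans[OF SUP_upper[OF that] 2] .
    ultimately show ?thesis by (simp add: INF_less_iff ennreal_less_iff)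
  qed
  show ?near
  proof (intro allI impI)
    fix e :: real assume "e > 0"
    then have "\<forall>\<^sub>F n in sequentially. hausdorff (C n) A < ennreal e"
      using order_tendstoD(2)[OF lim] by simp
    then have "\<forall>\<^sub>F n in sequentially. (\<forall>c\<in>C n. \<exists>a\<in>A. dist c a < e) \<and> (\<forall>a\<in>A. \<exists>c\<in>C n. dist c a < e)"
      by eventually_elim (rule less)
    then show "(\<forall>\<^sub>F n in sequentially. \<forall>c\<in>C n. \<exists>a\<in>A. dist c a < e) \<and>
           (\<forall>\<^sub>F n in sequentially. \<forall>a\<in>A. \<exists>c\<in>C n. dist c a < e)"
      by (simp add: eventually_conj_iff)
  qed
next
  assume near: ?near
  show ?lim
  proof (rule order_tendstoI)
    fix b :: ennreal assume "b > 0"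
    then obtain c where c: "0 < c" "c < b" using dense by blast
    then have "c < top" by (auto intro: order_less_le_trans)
    with c obtain e where e: "e > 0" "ennreal e < b"
      by (intro that[of "enn2real c"]) (simp_all add: enn2real_positive_iff)
    from near e(1) have "\<forall>\<^sub>F n in sequentially. \<forall>c\<in>C n. \<exists>a\<in>A. dist c a < e"
      "\<forall>\<^sub>F n in sequentially. \<forall>a\<in>A. \<exists>c\<in>C n. dist c a < e" by auto
    then show "\<forall>\<^sub>F n in sequentially. hausdorff (C n) A < b"
    proof eventually_elim
      case (elim n)
      have "hausdorff (C n) A \<le> ennreal e"
        unfolding hausdorff_def
      proof (intro max.boundedI SUP_least)
        fix c assume "c \<in> C n"
        with elim(1) obtain a where "a \<in> A" "dist c a < e" by blast
        then show "(INF a\<in>A. ennreal (dist c a)) \<le> ennreal e"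
          by (intro INF_lower2[of a]) (auto intro: ennreal_leI)
      next
        fix a assume "a \<in> A"
        with elim(2) obtain c where "c \<in> C n" "dist c a < e" by blast
        then show "(INF c\<in>C n. ennreal (dist c a)) \<le> ennreal e"
          by (intro INF_lower2[of c]) (auto intro: ennreal_leI)
      qed
      then show ?case using e(2) by (rule le_less_trans)
    qed
  qed simp
qed

lemma hausdorff_imp_K_lim:
  fixes C :: "nat \<Rightarrow> 'a::metric_space set"
  assumes lim: "(\<lambda>n. hausdorff (C n) A) \<longlonglongrightarrow> 0" and A: "closed A"
  shows "K_lim C A"
proof (rule K_limI)
  show "A \<subseteq> K_liminf C"
  proof
    fix a assume a: "a \<in> A"
    show "a \<in> K_liminf C"
      unfolding K_liminf_iff
    proof (intro allI impI)
      fix e :: real assume "e > 0"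
      with lim have "\<forall>\<^sub>F n in sequentially. \<forall>a\<in>A. \<exists>c\<in>C n. dist c a < e"
        unfolding hausdorff_tendsto_0_iff by blast
      then show "\<forall>\<^sub>F n in sequentially. \<exists>c\<in>C n. dist c a < e"
        by eventually_elim (use a in blast)
    qed
  qed
  show "K_limsup C \<subseteq> A"
  proof
    fix x assume x: "x \<in> K_limsup C"
    have "x \<in> closure A"
      unfolding closure_approachable
    proof (intro allI impI)
      fix e :: real assume "e > 0"
      then have "\<exists>\<^sub>F n in sequentially. \<exists>c\<in>C n. dist c x < e / 2"
        using x unfolding K_limsup_iff by (meson half_gt_zero)
      moreover have "\<forall>\<^sub>F n in sequentially. \<forall>c\<in>C n. \<exists>a\<in>A. dist c a < e / 2"
        using lim \<open>e > 0\<close> unfolding hausdorff_tendsto_0_iff by (meson half_gt_zero)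
      ultimately have "\<exists>\<^sub>F n in sequentially.
          (\<exists>c\<in>C n. dist c x < e / 2) \<and> (\<forall>c\<in>C n. \<exists>a\<in>A. dist c a < e / 2)"
        by (elim frequently_rev_mp) (auto elim: eventually_mono)
      then obtain c a where "dist c x < e / 2" "a \<in> A" "dist c a < e / 2"
        using frequently_ex by blast
      then show "\<exists>a\<in>A. dist a x < e"
        by (metis dist_commute dist_triangle_half_r)
    qed
    with A show "x \<in> A" by simp
  qed
qed

text \<open>The converse of the previous lemma can fail for sets that lose points to infinity; a common
  compact bound excludes this. For \<open>A = {}\<close> it even makes the sets \<open>C n\<close> eventually empty.\<close>

lemma K_lim_imp_hausdorff:
  fixes C :: "nat \<Rightarrow> 'a::metric_space set"
  assumes "K_lim C A" and "compact A" and "compact K" and "\<forall>\<^sub>F n in sequentially. C n \<subseteq> K"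
  shows "(\<lambda>n. hausdorff (C n) A) \<longlonglongrightarrow> 0"
  unfolding hausdorff_tendsto_0_iff
  using assms eventually_near_limit[of K C A] eventually_limit_near[of A C]
  by (auto simp: K_lim_def)

section \<open>Cuts, endographs and platform points\<close>

lemma level_cut_pos: "\<alpha> > 0 \<Longrightarrow> level_cut u \<alpha> = {x. u x \<ge> \<alpha>}"
  by (simp add: level_cut_def)

lemma F_USCG_range: "u \<in> F_USCG \<Longrightarrow> 0 \<le> u x \<and> u x \<le> 1"
  by (auto simp: F_USCG_def)

lemma F_USCGCON_range: "u \<in> F_USCGCON \<Longrightarrow> 0 \<le> u x \<and> u x \<le> 1"
  by (simp add: F_USCGCON_def F_USCG_range)

lemma F_USCG_compact_cut:
  fixes u :: "'a::heine_borel fuzzy"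
  assumes "u \<in> F_USCG" "0 < \<alpha>" "\<alpha> \<le> 1"
  shows "compact (level_cut u \<alpha>)"
  using assms by (auto simp: F_USCG_def compact_eq_bounded_closed intro!: closed_level_cut)

lemma closed_endograph:
  fixes u :: "'a::metric_space fuzzy"
  assumes usc: "upper_semicontinuous u"
  shows "closed (endograph u)"
  unfolding closed_def
proof (subst open_subopen, intro ballI)
  fix p assume "p \<in> - endograph u"
  then obtain x t where p: "p = (x, t)" "t \<notin> {0..1} \<or> u x < t"
    by (cases p) (force simp: endograph_def)
  show "\<exists>T. open T \<and> p \<in> T \<and> T \<subseteq> - endograph u"
  proof (cases "t \<in> {0..1}")
    case False
    then show ?thesis
      using p by (intro exI[of _ "UNIV \<times> (- {0..1})"]) (auto simp: endograph_def intro!: open_Times)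
  next
    case True
    then obtain b where b: "u x < b" "b < t" using p(2) dense by auto
    then obtain S where "open S" "x \<in> S" "\<forall>y\<in>S. u y < b"
      using usc unfolding upper_semicontinuous_def eventually_nhds by blast
    then show ?thesis
      using p b by (intro exI[of _ "S \<times> {b<..}"]) (auto simp: endograph_def intro!: open_Times)
  qed
qed

lemma top_level_props:
  fixes u :: "'a::heine_borel fuzzy"
  assumes "u \<in> F_USCG" and "u \<noteq> empty_fuzzy"
  shows "0 < top_level u" "top_level u \<le> 1" "\<And>x. u x \<le> top_level u" "\<exists>x. u x = top_level u"
proof -
  have top: "top_level u \<in> {0<..1} \<and>
      (\<forall>\<beta>\<in>{0..1}. level_cut u \<beta> \<noteq> {} \<longleftrightarrow> \<beta> \<in> {0..top_level u})"
    unfolding top_level_def by (rule theI'[OF top_level_unique[OF assms]])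
  then show pos: "0 < top_level u" and "top_level u \<le> 1" by auto
  show le: "u x \<le> top_level u" for x
  proof (rule ccontr)
    assume "\<not> u x \<le> top_level u"
    moreover from this have "level_cut u (u x) \<noteq> {}" using pos by (auto simp: level_cut_pos)
    ultimately show False using top F_USCG_range[OF assms(1), of x] by auto
  qed
  have "level_cut u (top_level u) \<noteq> {}" using top by auto
  then show "\<exists>x. u x = top_level u" using le pos by (fastforce simp: level_cut_pos intro: antisym)
qed

text \<open>A point that lies in the cut at \<open>\<alpha>\<close> but not in the closure of the strong cut has a basic
  neighbourhood on which the maximum of \<open>u\<close> is \<open>\<alpha>\<close>. This neighbourhood determines \<open>\<alpha>\<close>, and there
  are countably many of them.\<close>

lemma countable_platform_points:
  fixes u :: "'a::second_countable_topology fuzzy"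
  shows "countable (platform_points u)"
proof -
  obtain \<B> :: "'a set set" where \<B>: "countable \<B>" "topological_basis \<B>"
    using ex_countable_basis by blast
  have "\<exists>B\<in>\<B>. (\<exists>x\<in>B. u x \<ge> \<alpha>) \<and> (\<forall>x\<in>B. u x \<le> \<alpha>)" if "\<alpha> \<in> platform_points u" for \<alpha>
  proof -
    from that have "\<alpha> > 0" "\<not> level_cut u \<alpha> \<subseteq> closure (strong_cut u \<alpha>)"
      by (auto simp: platform_points_def)
    then obtain x where "u x \<ge> \<alpha>" "x \<notin> closure (strong_cut u \<alpha>)"
      by (auto simp: level_cut_pos)
    then obtain B where "B \<in> \<B>" "x \<in> B" "B \<subseteq> - closure (strong_cut u \<alpha>)"
      using topological_basisE[OF \<B>(2), of "- closure (strong_cut u \<alpha>)" x] by auto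
    moreover from this have "\<forall>y\<in>B. u y \<le> \<alpha>"
      using closure_subset[of "strong_cut u \<alpha>"] by (force simp: strong_cut_def)
    ultimately show ?thesis using \<open>u x \<ge> \<alpha>\<close> by blast
  qed
  then obtain B where B: "\<And>\<alpha>. \<alpha> \<in> platform_points u \<Longrightarrow>
      B \<alpha> \<in> \<B> \<and> (\<exists>x\<in>B \<alpha>. u x \<ge> \<alpha>) \<and> (\<forall>x\<in>B \<alpha>. u x \<le> \<alpha>)" by metis
  have "inj_on B (platform_points u)"
    by (rule inj_onI) (metis B antisym order_trans)
  moreover have "countable (B ` platform_points u)"
    using B by (auto intro: countable_subset[OF _ \<B>(1)])
  ultimately show ?thesis by (rule countable_image_inj_on[rotated])
qed

section \<open>From \<Gamma>-convergence to the cuts and back\<close>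

text \<open>Only the strong cut is reached in general: at a point of height exactly \<open>\<alpha>\<close> the approximating
  points of the endographs may lie slightly below \<open>\<alpha>\<close>.\<close>

lemma Gamma_liminf_cut:
  fixes u :: "'a::metric_space fuzzy"
  assumes G: "Gamma_converges U u" and x: "u x > \<alpha>" "u x \<le> 1" and \<alpha>: "\<alpha> > 0"
  shows "x \<in> K_liminf (\<lambda>n. level_cut (U n) \<alpha>)"
  unfolding K_liminf_iff
proof (intro allI impI)
  fix e :: real assume e: "e > 0"
  have "(x, u x) \<in> endograph u" using x \<alpha> by (simp add: endograph_def)
  then have "(x, u x) \<in> K_liminf (\<lambda>n. endograph (U n))"
    using G by (simp add: Gamma_converges_def K_lim_def)
  moreover have "min e (u x - \<alpha>) > 0" using e x by simp
  ultimately have "\<forall>\<^sub>F n in sequentially. \<exists>q\<in>endograph (U n). dist q (x, u x) < min e (u x - \<alpha>)"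
    unfolding K_liminf_iff by blast
  then show "\<forall>\<^sub>F n in sequentially. \<exists>y\<in>level_cut (U n) \<alpha>. dist y x < e"
  proof eventually_elim
    case (elim n)
    then obtain y s where q: "(y, s) \<in> endograph (U n)" "dist (y, s) (x, u x) < min e (u x - \<alpha>)"
      by auto
    have "dist y x < e" "dist s (u x) < u x - \<alpha>"
      using q(2) dist_fst_le[of "(y, s)" "(x, u x)"] dist_snd_le[of "(y, s)" "(x, u x)"] by auto
    then have "dist y x < e" "U n y \<ge> \<alpha>"
      using q(1) by (auto simp: endograph_def dist_real_def)
    then show ?case using \<alpha> by (auto simp: level_cut_pos)
  qed
qed

lemma Gamma_limsup_cut:
  fixes u :: "'a::metric_space fuzzy"
  assumes G: "Gamma_converges U u" and \<alpha>: "0 < \<alpha>" "\<alpha> \<le> 1"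
  shows "K_limsup (\<lambda>n. level_cut (U n) \<alpha>) \<subseteq> level_cut u \<alpha>"
proof
  fix x assume x: "x \<in> K_limsup (\<lambda>n. level_cut (U n) \<alpha>)"
  have "(x, \<alpha>) \<in> K_limsup (\<lambda>n. endograph (U n))"
    unfolding K_limsup_iff
  proof (intro allI impI)
    fix e :: real assume "e > 0"
    then have "\<exists>\<^sub>F n in sequentially. \<exists>y\<in>level_cut (U n) \<alpha>. dist y x < e"
      using x by (simp add: K_limsup_iff)
    then show "\<exists>\<^sub>F n in sequentially. \<exists>q\<in>endograph (U n). dist q (x, \<alpha>) < e"
    proof (rule frequently_elim1)
      fix n assume "\<exists>y\<in>level_cut (U n) \<alpha>. dist y x < e"
      then obtain y where "U n y \<ge> \<alpha>" "dist y x < e" using \<alpha> by (auto simp: level_cut_pos)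
      then show "\<exists>q\<in>endograph (U n). dist q (x, \<alpha>) < e"
        using \<alpha> by (intro bexI[of _ "(y, \<alpha>)"]) (auto simp: endograph_def dist_Pair_Pair)
    qed
  qed
  then have "(x, \<alpha>) \<in> endograph u" using G by (auto simp: Gamma_converges_def K_lim_def)
  then show "x \<in> level_cut u \<alpha>" using \<alpha> by (simp add: endograph_def level_cut_pos)
qed

text \<open>A limit inferior is closed, so containing the strong cut it contains its closure, and off the
  platform points this closure is the whole cut.\<close>

lemma Gamma_imp_K_lim_cut:
  fixes u :: "'a::metric_space fuzzy"
  assumes G: "Gamma_converges U u" and u: "u \<in> F_USCG"
    and \<alpha>: "\<alpha> \<in> {0<..<1} - platform_points u"
  shows "K_lim (\<lambda>n. level_cut (U n) \<alpha>) (level_cut u \<alpha>)"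
proof (rule K_limI)
  have "strong_cut u \<alpha> \<subseteq> level_cut u \<alpha>" using \<alpha> by (auto simp: strong_cut_def level_cut_pos)
  then have "closure (strong_cut u \<alpha>) \<subseteq> level_cut u \<alpha>"
    using u by (intro closure_minimal closed_level_cut) (auto simp: F_USCG_def)
  with \<alpha> have "level_cut u \<alpha> = closure (strong_cut u \<alpha>)" by (auto simp: platform_points_def)
  moreover have "strong_cut u \<alpha> \<subseteq> K_liminf (\<lambda>n. level_cut (U n) \<alpha>)"
    using \<alpha> F_USCG_range[OF u] Gamma_liminf_cut[OF G, of \<alpha>] by (auto simp: strong_cut_def)
  ultimately show "level_cut u \<alpha> \<subseteq> K_liminf (\<lambda>n. level_cut (U n) \<alpha>)"
    by (simp add: closure_minimal closed_K_liminf)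
  show "K_limsup (\<lambda>n. level_cut (U n) \<alpha>) \<subseteq> level_cut u \<alpha>"
    using \<alpha> by (intro Gamma_limsup_cut[OF G]) auto
qed

text \<open>A point \<open>(x, t)\<close> of the endograph of \<open>u\<close> is approximated through a cut at a level of \<open>P\<close> slightly
  below \<open>t\<close>. If \<open>(x, t)\<close> lay above the graph of \<open>u\<close> and were a limit superior point, a level of \<open>P\<close>
  strictly between \<open>u x\<close> and \<open>t\<close> would give a contradiction.\<close>

lemma dense_K_lim_cuts_imp_Gamma:
  fixes u :: "'a::metric_space fuzzy"
  assumes U: "\<And>n x. U n x \<ge> 0" and u: "u \<in> F_USCG"
    and P: "dense_subset P {0<..<1}"
    and lim: "\<And>\<alpha>. \<alpha> \<in> P \<Longrightarrow> K_lim (\<lambda>n. level_cut (U n) \<alpha>) (level_cut u \<alpha>)"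
  shows "Gamma_converges U u"
  unfolding Gamma_converges_def
proof (rule K_limI)
  have between: "\<exists>\<alpha>\<in>P. a < \<alpha> \<and> \<alpha> < b" if "0 \<le> a" "a < b" "b \<le> 1" for a b
  proof -
    have "(a + b) / 2 \<in> closure P" using P that by (auto simp: dense_subset_def)
    moreover have "(b - a) / 2 > 0" using that by simp
    ultimately obtain \<alpha> where \<alpha>: "\<alpha> \<in> P" "dist \<alpha> ((a + b) / 2) < (b - a) / 2"
      unfolding closure_approachable by blast
    from \<alpha>(2) have "a < \<alpha>" "\<alpha> < b" unfolding dist_real_def abs_less_iff by argo+
    with \<alpha>(1) show ?thesis by blast
  qed
  have P0: "0 < \<alpha>" "\<alpha> < 1" if "\<alpha> \<in> P" for \<alpha> using that P by (auto simp: dense_subset_def)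
  show "endograph u \<subseteq> K_liminf (\<lambda>n. endograph (U n))"
  proof
    fix p assume "p \<in> endograph u"
    then obtain x t where p: "p = (x, t)" "0 \<le> t" "t \<le> 1" "t \<le> u x"
      by (cases p) (auto simp: endograph_def)
    show "p \<in> K_liminf (\<lambda>n. endograph (U n))"
      unfolding K_liminf_iff
    proof (intro allI impI)
      fix e :: real assume e: "e > 0"
      show "\<forall>\<^sub>F n in sequentially. \<exists>q\<in>endograph (U n). dist q p < e"
      proof (cases "t = 0")
        case True
        then have "p \<in> endograph (U n)" for n using U p by (simp add: endograph_def)
        then show ?thesis using e by (intro always_eventually) force
      next
        case False
        then obtain \<alpha> where \<alpha>: "\<alpha> \<in> P" "max 0 (t - e / 2) < \<alpha>" "\<alpha> < t"
          using between[of "max 0 (t - e / 2)" t] p e by auto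
        then have "x \<in> level_cut u \<alpha>" using p by (simp add: level_cut_pos)
        then have "x \<in> K_liminf (\<lambda>n. level_cut (U n) \<alpha>)" using lim[OF \<alpha>(1)] by (simp add: K_lim_def)
        then have "\<forall>\<^sub>F n in sequentially. \<exists>y\<in>level_cut (U n) \<alpha>. dist y x < e / 2"
          using e half_gt_zero unfolding K_liminf_iff by blast
        then show ?thesis
        proof eventually_elim
          case (elim n)
          then obtain y where y: "U n y \<ge> \<alpha>" "dist y x < e / 2"
            using \<alpha> by (auto simp: level_cut_pos)
          have "dist (y, \<alpha>) p \<le> dist y x + dist \<alpha> t"
            unfolding p dist_Pair_Pair by (rule sqrt_sum_squares_le_sum) auto
          also have "dist \<alpha> t < e / 2" using \<alpha> by (auto simp: dist_real_def)
          finally have "dist (y, \<alpha>) p < e" using y(2) by simp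
          moreover have "(y, \<alpha>) \<in> endograph (U n)"
            using y P0[OF \<alpha>(1)] by (simp add: endograph_def)
          ultimately show ?case by blast
        qed
      qed
    qed
  qed
  show "K_limsup (\<lambda>n. endograph (U n)) \<subseteq> endograph u"
  proof
    fix p assume p: "p \<in> K_limsup (\<lambda>n. endograph (U n))"
    obtain x t where xt: "p = (x, t)" by (cases p)
    have near: "\<exists>\<^sub>F n in sequentially. \<exists>y s. 0 \<le> s \<and> s \<le> 1 \<and> s \<le> U n y \<and> dist y x < e \<and> dist s t < e"
      if "e > 0" for e
    proof -
      have "\<exists>\<^sub>F n in sequentially. \<exists>q\<in>endograph (U n). dist q p < e"
        using p that by (simp add: K_limsup_iff)
      then show ?thesis
      proof (rule frequently_elim1)
        fix n assume "\<exists>q\<in>endograph (U n). dist q p < e"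
        then obtain y s where q: "(y, s) \<in> endograph (U n)" "dist (y, s) (x, t) < e" using xt by auto
        moreover have "dist y x < e" "dist s t < e"
          using q(2) dist_fst_le[of "(y, s)" "(x, t)"] dist_snd_le[of "(y, s)" "(x, t)"] by auto
        ultimately show "\<exists>y s. 0 \<le> s \<and> s \<le> 1 \<and> s \<le> U n y \<and> dist y x < e \<and> dist s t < e"
          by (auto simp: endograph_def)
      qed
    qed
    have "t \<in> closure {0..1}"
      unfolding closure_approachable
    proof (intro allI impI)
      fix e :: real assume "e > 0"
      from frequently_ex[OF near[OF this]] show "\<exists>s\<in>{0..1}. dist s t < e" by auto
    qed
    then have t: "0 \<le> t" "t \<le> 1" by auto
    have "t \<le> u x"
    proof (rule ccontr)
      assume "\<not> t \<le> u x"
      then obtain \<alpha> where \<alpha>: "\<alpha> \<in> P" "u x < \<alpha>" "\<alpha> < t"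
        using between[of "u x" t] F_USCG_range[OF u] t by auto
      have "x \<in> K_limsup (\<lambda>n. level_cut (U n) \<alpha>)"
        unfolding K_limsup_iff
      proof (intro allI impI)
        fix e :: real assume "e > 0"
        then have "min e (t - \<alpha>) > 0" using \<alpha> by simp
        from near[OF this] show "\<exists>\<^sub>F n in sequentially. \<exists>y\<in>level_cut (U n) \<alpha>. dist y x < e"
          by (rule frequently_elim1) (use P0[OF \<alpha>(1)] in \<open>force simp: level_cut_pos dist_real_def\<close>)
      qed
      then have "x \<in> level_cut u \<alpha>" using lim[OF \<alpha>(1)] by (auto simp: K_lim_def)
      then show False using \<alpha> P0[OF \<alpha>(1)] by (simp add: level_cut_pos)
    qed
    with t show "p \<in> endograph u" by (simp add: endograph_def xt)
  qed
qed

section \<open>Uniform boundedness and the endograph metric\<close>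

text \<open>This is where connectedness enters. At a level below the maximum of \<open>u\<close>, the cuts of \<open>U n\<close>
  eventually have points near a point of the cut of \<open>u\<close>, hence inside a ball that contains this
  cut; by compactness they eventually miss the bounding sphere, which contains no point of the cut
  of \<open>u\<close>. Being connected, they stay inside the ball. For a higher level the cut is smaller.\<close>

lemma Gamma_connected_imp_bounded:
  fixes u :: "'a::euclidean_space fuzzy"
  assumes G: "Gamma_converges U u" and U: "\<And>n. U n \<in> F_USCGCON"
    and u: "u \<in> F_USCG" "u \<noteq> empty_fuzzy" and \<alpha>: "0 < \<alpha>" "\<alpha> \<le> 1"
  obtains K where "compact K" "\<forall>\<^sub>F n in sequentially. level_cut (U n) \<alpha> \<subseteq> K"
proof -
  obtain x where x: "u x > 0" using top_level_props(1,4)[OF u] by metis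
  have x1: "u x \<le> 1" using F_USCG_range[OF u(1)] by simp
  \<comment> \<open>a level strictly below a value of \<open>u\<close>, so that the limit inferior of the cuts is nonempty\<close>
  define \<beta> where "\<beta> = min \<alpha> (u x / 2)"
  have \<beta>: "0 < \<beta>" "\<beta> \<le> \<alpha>" "\<beta> < u x" "\<beta> \<le> 1" using x \<alpha> x1 by (auto simp: \<beta>_def)
  have "bounded (level_cut u \<beta>)" using F_USCG_compact_cut[OF u(1)] \<beta> compact_imp_bounded by blast
  then obtain R where "R > 0" and R: "level_cut u \<beta> \<subseteq> ball 0 R"
    using bounded_subset_ballD by blast
  have "x \<in> level_cut u \<beta>" using \<beta> by (simp add: level_cut_pos)
  then have "x \<in> ball 0 R" using R by blast
  then obtain e where e: "e > 0" "ball x e \<subseteq> ball 0 R" using open_contains_ball by blast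
  have "\<forall>\<^sub>F n in sequentially. \<exists>y\<in>level_cut (U n) \<beta>. dist y x < e"
    using Gamma_liminf_cut[OF G \<beta>(3) x1 \<beta>(1)] e(1) by (simp add: K_liminf_iff)
  moreover have "\<forall>\<^sub>F n in sequentially. level_cut (U n) \<beta> \<inter> sphere 0 R = {}"
  proof (rule eventually_disjoint_compact)
    show "sphere 0 R \<inter> K_limsup (\<lambda>n. level_cut (U n) \<beta>) = {}"
      using Gamma_limsup_cut[OF G \<beta>(1,4)] R by force
  qed simp
  ultimately have "\<forall>\<^sub>F n in sequentially. level_cut (U n) \<alpha> \<subseteq> cball 0 R"
  proof eventually_elim
    case (elim n)
    then obtain y where "y \<in> level_cut (U n) \<beta>" "dist y x < e" by blast
    then have "level_cut (U n) \<beta> \<inter> ball 0 R \<noteq> {}" using e(2) by (auto simp: dist_commute)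
    moreover have "connected (level_cut (U n) \<beta>)"
      using U[of n] \<beta> by (simp add: F_USCGCON_def)
    moreover have "frontier (ball 0 R) = (sphere 0 R :: 'a set)" using \<open>R > 0\<close> by (simp add: frontier_ball)
    ultimately have "level_cut (U n) \<beta> \<subseteq> ball 0 R"
      using connected_Int_frontier[of "level_cut (U n) \<beta>" "ball 0 R"] elim(2) by auto
    moreover have "level_cut (U n) \<alpha> \<subseteq> level_cut (U n) \<beta>"
      using \<alpha> \<beta> by (auto simp: level_cut_pos)
    ultimately show ?case using ball_subset_cball by blast
  qed
  with that[of "cball 0 R"] show thesis by simp
qed

text \<open>Endographs need not be compact, because they contain the whole space at height 0. However, points
  below height \<open>e\<close> are within \<open>e\<close> of that common bottom, and the parts above a positive height lie
  over cuts, where the compactness lemmas apply.\<close>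

lemma Gamma_bounded_imp_H_end:
  fixes u :: "'a::heine_borel fuzzy"
  assumes G: "Gamma_converges U u" and U: "\<And>n x. U n x \<ge> 0" and u: "u \<in> F_USCG"
    and bd: "\<And>\<alpha>. 0 < \<alpha> \<Longrightarrow> \<alpha> \<le> 1 \<Longrightarrow>
      \<exists>K. compact K \<and> (\<forall>\<^sub>F n in sequentially. level_cut (U n) \<alpha> \<subseteq> K)"
  shows "(\<lambda>n. H_end (U n) u) \<longlonglongrightarrow> 0"
  unfolding H_end_def hausdorff_tendsto_0_iff
proof (intro allI impI)
  fix e :: real assume "e > 0"
  define d where "d = min e 1 / 2"
  have d: "0 < d" "d \<le> 1" "d < e" using \<open>e > 0\<close> by (auto simp: d_def)
  let ?high = "UNIV \<times> {d..1}"
  have high: "endograph v \<inter> ?high \<subseteq> level_cut v d \<times> {d..1}" for v :: "'a fuzzy"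
    using d by (auto simp: endograph_def level_cut_pos)
  \<comment> \<open>a point below height \<open>d\<close> lies within \<open>d\<close> of the bottom, which every endograph contains\<close>
  have low: "\<exists>q\<in>endograph w. dist q p < e"
    if "p \<in> endograph v" "p \<notin> ?high" "\<And>x. w x \<ge> 0" for p :: "'a \<times> real" and v w
    using that d by (intro bexI[of _ "(fst p, 0)"])
      (auto simp: endograph_def dist_Pair_Pair dist_real_def)
  have low': "\<exists>q\<in>endograph w. dist p q < e"
    if "p \<in> endograph v" "p \<notin> ?high" "\<And>x. w x \<ge> 0" for p :: "'a \<times> real" and v w
    using low[OF that] by (simp add: dist_commute)
  have lim: "endograph u = K_liminf (\<lambda>n. endograph (U n))" "endograph u = K_limsup (\<lambda>n. endograph (U n))"
    using G by (auto simp: Gamma_converges_def K_lim_def)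
  obtain K where K: "compact K" "\<forall>\<^sub>F n in sequentially. level_cut (U n) d \<subseteq> K" using bd d by blast
  have "\<forall>\<^sub>F n in sequentially. \<forall>q\<in>endograph (U n) \<inter> ?high. \<exists>p\<in>endograph u. dist q p < e"
  proof (rule eventually_near_limit)
    show "compact (K \<times> {d..1})" using K by (intro compact_Times) auto
    show "\<forall>\<^sub>F n in sequentially. endograph (U n) \<inter> ?high \<subseteq> K \<times> {d..1}"
      using K(2) by eventually_elim (use high in blast)
    show "K_limsup (\<lambda>n. endograph (U n) \<inter> ?high) \<subseteq> endograph u"
      unfolding lim(2) K_limsup_def by blast
  qed fact
  then have 1: "\<forall>\<^sub>F n in sequentially. \<forall>q\<in>endograph (U n). \<exists>p\<in>endograph u. dist q p < e"
  proof eventually_elim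
    case (elim n)
    show ?case
    proof
      fix q assume "q \<in> endograph (U n)"
      then show "\<exists>p\<in>endograph u. dist q p < e"
        using elim low'[of q "U n" u] F_USCG_range[OF u] by blast
    qed
  qed
  have "compact (endograph u \<inter> ?high)"
  proof -
    have "endograph u \<inter> ?high = (level_cut u d \<times> {d..1}) \<inter> endograph u" using high by blast
    moreover have "compact (level_cut u d \<times> {d..1})"
      using F_USCG_compact_cut[OF u] d by (intro compact_Times) auto
    moreover have "closed (endograph u)"
      using u by (intro closed_endograph) (simp add: F_USCG_def)
    ultimately show ?thesis by (simp add: compact_Int_closed)
  qed
  then have "\<forall>\<^sub>F n in sequentially. \<forall>p\<in>endograph u \<inter> ?high. \<exists>q\<in>endograph (U n). dist q p < e"
    by (rule eventually_limit_near) (use lim \<open>e > 0\<close> in auto)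
  then have "\<forall>\<^sub>F n in sequentially. \<forall>p\<in>endograph u. \<exists>q\<in>endograph (U n). dist q p < e"
  proof eventually_elim
    case (elim n)
    show ?case
    proof
      fix p assume "p \<in> endograph u"
      then show "\<exists>q\<in>endograph (U n). dist q p < e"
        using elim low[of p u "U n"] U by blast
    qed
  qed
  with 1 show "(\<forall>\<^sub>F n in sequentially. \<forall>q\<in>endograph (U n). \<exists>p\<in>endograph u. dist q p < e) \<and>
      (\<forall>\<^sub>F n in sequentially. \<forall>p\<in>endograph u. \<exists>q\<in>endograph (U n). dist q p < e)" ..
qed

section \<open>Density and null sets of levels\<close>

text \<open>An open set of levels at which \<open>Q\<close> fails is negligible, hence empty.\<close>

lemma AE_imp_dense_subset:
  fixes S :: "real set"
  assumes S: "open S" and ae: "AE \<alpha> in lebesgue. \<alpha> \<in> S \<longrightarrow> Q \<alpha>"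
  shows "dense_subset {\<alpha>\<in>S. Q \<alpha>} S"
proof -
  have neg: "negligible {\<alpha>\<in>S. \<not> Q \<alpha>}"
  proof -
    obtain N where "N \<in> null_sets lebesgue" "{\<alpha>\<in>space lebesgue. \<not> (\<alpha> \<in> S \<longrightarrow> Q \<alpha>)} \<subseteq> N"
      using ae unfolding eventually_ae_filter by blast
    then have "negligible N" "{\<alpha>\<in>S. \<not> Q \<alpha>} \<subseteq> N"
      by (simp_all add: negligible_iff_null_sets subset_iff)
    then show ?thesis by (rule negligible_subset)
  qed
  have "S - closure {\<alpha>\<in>S. Q \<alpha>} = {}"
  proof (rule ccontr)
    assume "S - closure {\<alpha>\<in>S. Q \<alpha>} \<noteq> {}"
    moreover have "open (S - closure {\<alpha>\<in>S. Q \<alpha>})" using S by (intro open_Diff) auto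
    moreover have "S - closure {\<alpha>\<in>S. Q \<alpha>} \<subseteq> {\<alpha>\<in>S. \<not> Q \<alpha>}"
      using closure_subset[of "{\<alpha>\<in>S. Q \<alpha>}"] by blast
    ultimately show False using neg negligible_subset open_not_negligible by blast
  qed
  then show ?thesis by (auto simp: dense_subset_def)
qed

lemma countable_AE_lebesgue:
  fixes S :: "real set"
  assumes "countable S" "\<And>\<alpha>. \<alpha> \<notin> S \<Longrightarrow> Q \<alpha>"
  shows "AE \<alpha> in lebesgue. Q \<alpha>"
proof -
  have "AE \<alpha> in lebesgue. \<alpha> \<notin> S"
    using assms(1) by (intro AE_completion AE_not_in countable_imp_null_set_lborel)
  then show ?thesis by eventually_elim (rule assms(2))
qed
lemma dense_subset_trans:
  assumes "dense_subset P S" "dense_subset S T"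
  shows "dense_subset P T"
  using assms closure_minimal[of S "closure P"] unfolding dense_subset_def
  by (meson closed_closure subset_trans)

lemma dense_subset_Diff_countable:
  fixes S C :: "real set"
  assumes "open S" "countable C"
  shows "dense_subset (S - C) S"
proof -
  have "AE \<alpha> in lebesgue. \<alpha> \<notin> C" using assms(2) by (rule countable_AE_lebesgue) auto
  then have "AE \<alpha> in lebesgue. \<alpha> \<in> S \<longrightarrow> \<alpha> \<notin> C" by eventually_elim simp
  from AE_imp_dense_subset[OF assms(1) this] show ?thesis by (simp add: set_diff_eq)
qed

text \<open>A set of levels in \<open>(0,1)\<close> that avoids the platform points therefore splits into levels
  strictly below and levels strictly above the top level.\<close>

lemma top_level_platform:
  fixes u :: "'a::heine_borel fuzzy"
  assumes u: "u \<in> F_USCG" "u \<noteq> empty_fuzzy" and "top_level u < 1"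
  shows "top_level u \<in> platform_points u"
proof -
  have "strong_cut u (top_level u) = {}"
    using top_level_props(3)[OF u] by (auto simp: strong_cut_def not_less)
  moreover obtain x where "u x = top_level u" using top_level_props(4)[OF u] by blast
  then have "x \<in> level_cut u (top_level u)"
    using top_level_props(1)[OF u] by (simp add: level_cut_pos)
  ultimately show ?thesis
    using assms(3) top_level_props(1)[OF u] by (auto simp: platform_points_def)
qed

section \<open>Equivalence of the convergences\<close>

theorem theorem9p3:
  fixes U :: "nat \<Rightarrow> (real ^ 'm) fuzzy" and u :: "(real ^ 'm) fuzzy"
  assumes "\<And>n. U n \<in> F_USCGCON"
    and "u \<in> F_USCG" and "u \<noteq> empty_fuzzy"
  shows
   "(((\<lambda>n. H_end (U n) u) \<longlonglongrightarrow> 0) \<longleftrightarrow>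
       (AE \<alpha> in lebesgue. \<alpha> \<in> {0<..<1} \<longrightarrow> (\<lambda>n. hausdorff (level_cut (U n) \<alpha>) (level_cut u \<alpha>)) \<longlonglongrightarrow> 0)) \<and>
    (((\<lambda>n. H_end (U n) u) \<longlonglongrightarrow> 0) \<longleftrightarrow>
       (\<forall>\<alpha>\<in>{0<..<1} - platform_points u. (\<lambda>n. hausdorff (level_cut (U n) \<alpha>) (level_cut u \<alpha>)) \<longlonglongrightarrow> 0)) \<and>
    (((\<lambda>n. H_end (U n) u) \<longlonglongrightarrow> 0) \<longleftrightarrow>
       (\<exists>P. dense_subset P ({0<..<1} - platform_points u) \<and> 
          (\<forall>\<alpha>\<in>P. (\<lambda>n. hausdorff (level_cut (U n) \<alpha>) (level_cut u \<alpha>)) \<longlonglongrightarrow> 0))) \<and>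
    (((\<lambda>n. H_end (U n) u) \<longlonglongrightarrow> 0) \<longleftrightarrow>
       (\<exists>P. countable P \<and> dense_subset P ({0<..<1} - platform_points u) \<and> 
          (\<forall>\<alpha>\<in>P. (\<lambda>n. hausdorff (level_cut (U n) \<alpha>) (level_cut u \<alpha>)) \<longlonglongrightarrow> 0))) \<and>
    (((\<lambda>n. H_end (U n) u) \<longlonglongrightarrow> 0) \<longleftrightarrow>
       (Gamma_converges U u)) \<and>
    (((\<lambda>n. H_end (U n) u) \<longlonglongrightarrow> 0) \<longleftrightarrow>
       (\<forall>\<alpha>\<in>{0<..<1} - platform_points u. K_lim (\<lambda>n. level_cut (U n) \<alpha>) (level_cut u \<alpha>))) \<and>
    (((\<lambda>n. H_end (U n) u) \<longlonglongrightarrow> 0) \<longleftrightarrow>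
       ((\<forall>\<alpha>\<in>{top_level u<..1}. K_lim (\<lambda>n. level_cut (U n) \<alpha>) (level_cut u \<alpha>) \<and> level_cut u \<alpha> = {}) \<and> 
        (\<forall>\<alpha>\<in>{0<..<top_level u} - platform_points u. (\<lambda>n. hausdorff (level_cut (U n) \<alpha>) (level_cut u \<alpha>)) \<longlonglongrightarrow> 0))) \<and>
    (((\<lambda>n. H_end (U n) u) \<longlonglongrightarrow> 0) \<longleftrightarrow>
       (AE \<alpha> in lebesgue. \<alpha> \<in> {0<..<1} \<longrightarrow> K_lim (\<lambda>n. level_cut (U n) \<alpha>) (level_cut u \<alpha>))) \<and>
    (((\<lambda>n. H_end (U n) u) \<longlonglongrightarrow> 0) \<longleftrightarrow>
       ((\<forall>\<alpha>\<in>{top_level u<..1}. K_lim (\<lambda>n. level_cut (U n) \<alpha>) (level_cut u \<alpha>) \<and> level_cut u \<alpha> = {}) \<and> 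
        (AE \<alpha> in lebesgue. \<alpha> \<in> {0<..<top_level u} \<longrightarrow> (\<lambda>n. hausdorff (level_cut (U n) \<alpha>) (level_cut u \<alpha>)) \<longlonglongrightarrow> 0))) \<and>
    (((\<lambda>n. H_end (U n) u) \<longlonglongrightarrow> 0) \<longleftrightarrow>
       (\<exists>P. dense_subset P ({0<..<1} - platform_points u) \<and> 
          (\<forall>\<alpha>\<in>P. K_lim (\<lambda>n. level_cut (U n) \<alpha>) (level_cut u \<alpha>)))) \<and>
    (((\<lambda>n. H_end (U n) u) \<longlonglongrightarrow> 0) \<longleftrightarrow>
       ((\<forall>\<alpha>\<in>{top_level u<..1}. K_lim (\<lambda>n. level_cut (U n) \<alpha>) (level_cut u \<alpha>) \<and> level_cut u \<alpha> = {}) \<and> 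
        (\<exists>P. dense_subset P ({0<..<1} - platform_points u) \<and> 
          (\<forall>\<alpha>\<in>P \<inter> {0<..<top_level u}. (\<lambda>n. hausdorff (level_cut (U n) \<alpha>) (level_cut u \<alpha>)) \<longlonglongrightarrow> 0)))) \<and>
    (((\<lambda>n. H_end (U n) u) \<longlonglongrightarrow> 0) \<longleftrightarrow>
       (\<exists>P. countable P \<and> dense_subset P ({0<..<1} - platform_points u) \<and> 
          (\<forall>\<alpha>\<in>P. K_lim (\<lambda>n. level_cut (U n) \<alpha>) (level_cut u \<alpha>)))) \<and>
    (((\<lambda>n. H_end (U n) u) \<longlonglongrightarrow> 0) \<longleftrightarrow>
       ((\<forall>\<alpha>\<in>{top_level u<..1}. K_lim (\<lambda>n. level_cut (U n) \<alpha>) (level_cut u \<alpha>) \<and> level_cut u \<alpha> = {}) \<and> 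
        (\<exists>P. countable P \<and> dense_subset P ({0<..<1} - platform_points u) \<and> 
          (\<forall>\<alpha>\<in>P \<inter> {0<..<top_level u}. (\<lambda>n. hausdorff (level_cut (U n) \<alpha>) (level_cut u \<alpha>)) \<longlonglongrightarrow> 0))))"
proof -
  note U = assms(1) and u = assms(2) assms(3)
  let ?E = "(\<lambda>n. H_end (U n) u) \<longlonglongrightarrow> 0"
  let ?H = "\<lambda>\<alpha>. (\<lambda>n. hausdorff (level_cut (U n) \<alpha>) (level_cut u \<alpha>)) \<longlonglongrightarrow> 0"
  let ?K = "\<lambda>\<alpha>. K_lim (\<lambda>n. level_cut (U n) \<alpha>) (level_cut u \<alpha>)"
  let ?S = "{0<..<1} - platform_points u"
  let ?T = "\<forall>\<alpha>\<in>{top_level u<..1}. ?K \<alpha> \<and> level_cut u \<alpha> = {}"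
  have usc: "upper_semicontinuous u" using u by (simp add: F_USCG_def)
  have U0: "U n x \<ge> 0" for n x using F_USCGCON_range[OF U] by simp
  have HK: "?K \<alpha>" if "?H \<alpha>" for \<alpha>
    using that closed_level_cut[OF usc] by (rule hausdorff_imp_K_lim)
  \<comment> \<open>the sole use of the connectedness of the cuts of \<open>U n\<close>\<close>
  have bd: "\<exists>K. compact K \<and> (\<forall>\<^sub>F n in sequentially. level_cut (U n) \<alpha> \<subseteq> K)"
    if "Gamma_converges U u" "0 < \<alpha>" "\<alpha> \<le> 1" for \<alpha>
    using Gamma_connected_imp_bounded[OF that(1) U u that(2,3)] by blast
  have EG: "?E \<longleftrightarrow> Gamma_converges U u"
  proof
    assume ?E
    then show "Gamma_converges U u"
      unfolding Gamma_converges_def H_end_def using closed_endograph[OF usc] by (rule hausdorff_imp_K_lim)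
  next
    assume "Gamma_converges U u"
    then show ?E using bd by (intro Gamma_bounded_imp_H_end U0 u)
  qed
  have E_H: "\<forall>\<alpha>\<in>?S. ?H \<alpha>" if ?E
  proof
    fix \<alpha> assume \<alpha>: "\<alpha> \<in> ?S"
    from that have G: "Gamma_converges U u" by (simp add: EG)
    obtain K where "compact K" "\<forall>\<^sub>F n in sequentially. level_cut (U n) \<alpha> \<subseteq> K"
      using bd[OF G, of \<alpha>] \<alpha> by auto
    moreover have "compact (level_cut u \<alpha>)" using F_USCG_compact_cut[OF u(1)] \<alpha> by simp
    ultimately show "?H \<alpha>"
      using Gamma_imp_K_lim_cut[OF G u(1) \<alpha>] by (intro K_lim_imp_hausdorff)
  qed
  have E_T: ?T if ?E
  proof
    fix \<alpha> assume \<alpha>: "\<alpha> \<in> {top_level u<..1}"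
    from that have G: "Gamma_converges U u" by (simp add: EG)
    have \<alpha>01: "0 < \<alpha>" "\<alpha> \<le> 1" using \<alpha> top_level_props(1)[OF u] by auto
    have "u x < \<alpha>" for x using \<alpha> top_level_props(3)[OF u, of x] by simp
    then have empty: "level_cut u \<alpha> = {}" using \<alpha>01 by (simp add: level_cut_pos not_le)
    moreover have "?K \<alpha>"
      using Gamma_limsup_cut[OF G \<alpha>01] empty by (intro K_limI) auto
    ultimately show "?K \<alpha> \<and> level_cut u \<alpha> = {}" by simp
  qed
  have dense_S: "dense_subset ?S {0<..<1}"
    using countable_platform_points by (intro dense_subset_Diff_countable) auto
  \<comment> \<open>the weakest of the conditions: Kuratowski convergence on some dense set of levels\<close>
  have K_E: ?E if "dense_subset P ?S" "\<forall>\<alpha>\<in>P. ?K \<alpha>" for P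
    unfolding EG using dense_subset_trans[OF that(1) dense_S] that(2)
    by (intro dense_K_lim_cuts_imp_Gamma[OF U0 u(1)]) auto
  have AE_K_E: ?E if "AE \<alpha> in lebesgue. \<alpha> \<in> {0<..<1} \<longrightarrow> ?K \<alpha>"
    unfolding EG
    by (rule dense_K_lim_cuts_imp_Gamma[OF U0 u(1) AE_imp_dense_subset[OF _ that]]) auto
  \<comment> \<open>the top level lies in no such \<open>P\<close> (it is a platform point or equals 1)\<close>
  have split_E: ?E if P: "dense_subset P ?S" and T: ?T and H: "\<forall>\<alpha>\<in>P \<inter> {0<..<top_level u}. ?H \<alpha>" for P
  proof (rule K_E[OF P], rule ballI)
    fix \<alpha> assume \<alpha>: "\<alpha> \<in> P"
    then have S: "\<alpha> \<in> ?S" using P by (auto simp: dense_subset_def)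
    then have "\<alpha> \<noteq> top_level u" using top_level_platform[OF u] by auto
    then consider "\<alpha> < top_level u" | "\<alpha> > top_level u" by linarith
    then show "?K \<alpha>"
    proof cases
      case 1
      then show ?thesis using \<alpha> S H by (intro HK) auto
    next
      case 2
      then have "\<alpha> \<in> {top_level u<..1}" using S by simp
      then show ?thesis using T by blast
    qed
  qed
  have dense_refl: "dense_subset ?S ?S" by (simp add: dense_subset_def closure_subset)
  obtain Q where Q: "countable Q" "dense_subset Q ?S"
    using separable[of ?S] unfolding dense_subset_def by metis
  have top1: "top_level u \<le> 1" by (rule top_level_props(2)[OF u])
  have E_AE_H: "AE \<alpha> in lebesgue. \<alpha> \<in> {0<..<1} \<longrightarrow> ?H \<alpha>" if ?E
    using E_H[OF that] by (intro countable_AE_lebesgue[OF countable_platform_points[of u]]) auto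
  have AE_H_K: "AE \<alpha> in lebesgue. \<alpha> \<in> {0<..<1} \<longrightarrow> ?K \<alpha>"
    if "AE \<alpha> in lebesgue. \<alpha> \<in> {0<..<1} \<longrightarrow> ?H \<alpha>"
    using that by eventually_elim (use HK in blast)
  have c2: "?E \<longleftrightarrow> (AE \<alpha> in lebesgue. \<alpha> \<in> {0<..<1} \<longrightarrow> ?H \<alpha>)"
    using E_AE_H AE_H_K AE_K_E by blast
  have c9: "?E \<longleftrightarrow> (AE \<alpha> in lebesgue. \<alpha> \<in> {0<..<1} \<longrightarrow> ?K \<alpha>)"
    using E_AE_H AE_H_K AE_K_E by blast
  have c3: "?E \<longleftrightarrow> (\<forall>\<alpha>\<in>?S. ?H \<alpha>)"
    using E_H K_E[OF dense_refl] HK by blast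
  have c7: "?E \<longleftrightarrow> (\<forall>\<alpha>\<in>?S. ?K \<alpha>)"
    using E_H K_E[OF dense_refl] HK by blast
  have c8: "?E \<longleftrightarrow> ?T \<and> (\<forall>\<alpha>\<in>{0<..<top_level u} - platform_points u. ?H \<alpha>)"
    using E_H E_T split_E[OF dense_refl] top1 by fastforce
  have c10: "?E \<longleftrightarrow> ?T \<and> (AE \<alpha> in lebesgue. \<alpha> \<in> {0<..<top_level u} \<longrightarrow> ?H \<alpha>)"
  proof
    assume ?E
    from E_AE_H[OF this] have "AE \<alpha> in lebesgue. \<alpha> \<in> {0<..<top_level u} \<longrightarrow> ?H \<alpha>"
      by eventually_elim (use top1 in auto)
    with E_T[OF \<open>?E\<close>] show "?T \<and> (AE \<alpha> in lebesgue. \<alpha> \<in> {0<..<top_level u} \<longrightarrow> ?H \<alpha>)" ..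
  next
    assume *: "?T \<and> (AE \<alpha> in lebesgue. \<alpha> \<in> {0<..<top_level u} \<longrightarrow> ?H \<alpha>)"
    \<comment> \<open>nothing is known at the top level itself, which is a null set\<close>
    have "AE \<alpha> in lebesgue. \<alpha> \<noteq> top_level u"
      by (rule countable_AE_lebesgue[of "{top_level u}"]) auto
    with conjunct2[OF *] have "AE \<alpha> in lebesgue. \<alpha> \<in> {0<..<1} \<longrightarrow> ?K \<alpha>"
    proof eventually_elim
      case (elim \<alpha>)
      show ?case
      proof
        assume \<alpha>: "\<alpha> \<in> {0<..<1}"
        consider "\<alpha> < top_level u" | "\<alpha> > top_level u" using elim(2) by linarith
        then show "?K \<alpha>"
        proof cases
          case 1
          then show ?thesis using elim(1) \<alpha> by (intro HK) auto
        next
          case 2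
          then have "\<alpha> \<in> {top_level u<..1}" using \<alpha> by simp
          then show ?thesis using * by blast
        qed
      qed
    qed
    then show ?E by (rule AE_K_E)
  qed
  have c4: "?E \<longleftrightarrow> (\<exists>P. dense_subset P ?S \<and> (\<forall>\<alpha>\<in>P. ?H \<alpha>))"
    using E_H K_E dense_refl HK by blast
  have c11: "?E \<longleftrightarrow> (\<exists>P. dense_subset P ?S \<and> (\<forall>\<alpha>\<in>P. ?K \<alpha>))"
    using E_H K_E dense_refl HK by blast
  have Q_H: "\<forall>\<alpha>\<in>Q. ?H \<alpha>" if ?E
    using E_H[OF that] Q(2) unfolding dense_subset_def by blast
  have c5: "?E \<longleftrightarrow> (\<exists>P. countable P \<and> dense_subset P ?S \<and> (\<forall>\<alpha>\<in>P. ?H \<alpha>))"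
    using Q_H Q K_E HK by blast
  have c13: "?E \<longleftrightarrow> (\<exists>P. countable P \<and> dense_subset P ?S \<and> (\<forall>\<alpha>\<in>P. ?K \<alpha>))"
    using Q_H Q K_E HK by blast
  have c12: "?E \<longleftrightarrow> ?T \<and> (\<exists>P. dense_subset P ?S \<and> (\<forall>\<alpha>\<in>P \<inter> {0<..<top_level u}. ?H \<alpha>))"
    using Q_H Q E_T split_E by blast
  have c14: "?E \<longleftrightarrow> ?T \<and> (\<exists>P. countable P \<and> dense_subset P ?S \<and> (\<forall>\<alpha>\<in>P \<inter> {0<..<top_level u}. ?H \<alpha>))"
    using Q_H Q E_T split_E by blast
  show ?thesis
    by (intro conjI) (fact c2 c3 c4 c5 EG c7 c8 c9 c10 c11 c12 c13 c14)+
qed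

end
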